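(* Let $c_0,c_h>0$ be constants and consider the Maxwell-GLM system for $\mathbf{q}=(\mathbf{B},\phi,\mathbf{E},\psi)\in\mathbb{R}^8$ on $\mathbb{R}_t\times\mathbb{R}^3$: $$\partial_t\mathbf{B}+c_0\nabla\times\mathbf{E}+c_h\nabla\phi=0,\qquad \partial_t\phi+c_h\nabla\cdot\mathbf{B}=0,$$ $$\partial_t\mathbf{E}-c_0\nabla\times\mathbf{B}+c_h\nabla\psi=0,\qquad \partial_t\psi+c_h\nabla\cdot\mathbf{E}=0.$$ Then: (1) every smooth solution satisfies the additional conservation law $$\partial_t\mathcal{E}+\nabla\cdot\big(c_0\,\mathbf{E}\times\mathbf{B}+c_h(\psi\mathbf{E}+\phi\mathbf{B})\big)=0,\qquad \mathcal{E}=\tfrac12(|\mathbf{E}|^2+|\mathbf{B}|^2)+\tfrac12(\psi^2+\phi^2);$$ (2) the system is symmetric hyperbolic in the sense of Friedrichs: in terms of $\mathbf{p}=\partial\mathcal{E}/\partial\mathbf{q}$ it can be written as $\mathbf{M}\,\partial_t\mathbf{p}+\sum_{k=1}^3\mathbf{H}_k\,\partial_k\mathbf{p}=0$ with $\mathbf{M}$ symmetric positive definite (here $\mathbf{M}=\mathbf{I}$) and constant symmetric $8\times 8$ matrices $\mathbf{H}_1,\mathbf{H}_2,\mathbf{H}_3$.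
   Context: A first-order system $\mathbf{M}\partial_t\mathbf{p}+\sum_k\mathbf{H}_k\partial_k\mathbf{p}=0$ is symmetric hyperbolic in the sense of Friedrichs if $\mathbf{M}$ is symmetric positive definite and all $\mathbf{H}_k$ are symmetric. Explicitly, with $\mathbf{e}_k$ the standard basis vectors of $\mathbb{R}^3$, $\mathbf{H}_k$ acts as $\mathbf{H}_k(\mathbf{B},\phi,\mathbf{E},\psi)=(c_0\,\mathbf{e}_k\times\mathbf{E}+c_h\phi\,\mathbf{e}_k,\ c_hB_k,\ -c_0\,\mathbf{e}_k\times\mathbf{B}+c_h\psi\,\mathbf{e}_k,\ c_hE_k)$. For the quadratic energy above $\mathbf{p}=\mathbf{q}$, and $\mathbf{M}=L_{\mathbf{p}\mathbf{p}}$ is the Hessian of the Legendre transform $L=\mathbf{p}\cdot\mathbf{q}-\mathcal{E}$. *)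

theory Defs
  imports "HOL-Analysis.Analysis"
begin

section \<open>Differential calculus\<close>

primrec C_k :: "nat \<Rightarrow> ('a::real_normed_vector \<Rightarrow> 'b::real_normed_vector) \<Rightarrow> bool" where
  "C_k 0 f \<longleftrightarrow> continuous_on UNIV f"
| "C_k (Suc k) f \<longleftrightarrow>
     (\<forall>x. f differentiable (at x)) \<and> (\<forall>v. C_k k (\<lambda>x. frechet_derivative f (at x) v))"

definition smooth :: "('a::real_normed_vector \<Rightarrow> 'b::real_normed_vector) \<Rightarrow> bool" where
  "smooth f \<longleftrightarrow> (\<forall>k. C_k k f)"

definition partial_deriv ::
    "'n::finite \<Rightarrow> (real^'n \<Rightarrow> 'b::real_normed_vector) \<Rightarrow> real^'n \<Rightarrow> 'b" where
  "partial_deriv i f x = vector_derivative (\<lambda>s. f (x + s *\<^sub>R axis i 1)) (at 0)"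

definition gradient :: "(real^'n::finite \<Rightarrow> real) \<Rightarrow> real^'n \<Rightarrow> real^'n" where
  "gradient f x = (\<chi> i. partial_deriv i f x)"

definition hessian :: "(real^'n::finite \<Rightarrow> real) \<Rightarrow> real^'n \<Rightarrow> real^'n^'n" where
  "hessian f x = (\<chi> i j. partial_deriv i (partial_deriv j f) x)"

definition divergence :: "(real^'n::finite \<Rightarrow> real^'n) \<Rightarrow> real^'n \<Rightarrow> real" where
  "divergence F x = (\<Sum>k\<in>UNIV. partial_deriv k (\<lambda>y. F y $ k) x)"

definition curl :: "(real^3 \<Rightarrow> real^3) \<Rightarrow> real^3 \<Rightarrow> real^3" where
  "curl F x = vector
     [partial_deriv 2 (\<lambda>y. F y $ 3) x - partial_deriv 3 (\<lambda>y. F y $ 2) x,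
      partial_deriv 3 (\<lambda>y. F y $ 1) x - partial_deriv 1 (\<lambda>y. F y $ 3) x,
      partial_deriv 1 (\<lambda>y. F y $ 2) x - partial_deriv 2 (\<lambda>y. F y $ 1) x]"

text \<open>The classical Legendre transform \<open>p \<bullet> q - f q\<close>, with \<open>q\<close> expressed through \<open>p\<close> by
  inverting \<open>p = gradient f q\<close>. It is meaningful only where that equation has exactly one solution.\<close>

definition legendre :: "(real^'n::finite \<Rightarrow> real) \<Rightarrow> real^'n \<Rightarrow> real" where
  "legendre f p = (let q = (THE q. gradient f q = p) in p \<bullet> q - f q)"


section \<open>Symmetric hyperbolicity\<close>

definition symmetric_matrix :: "real^'n^'n \<Rightarrow> bool" where
  "symmetric_matrix A \<longleftrightarrow> transpose A = A"

definition positive_definite :: "real^'n^'n \<Rightarrow> bool" where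
  "positive_definite A \<longleftrightarrow> (\<forall>x. x \<noteq> 0 \<longrightarrow> 0 < x \<bullet> (A *v x))"

definition friedrichs_symmetric_hyperbolic :: "real^'n^'n \<Rightarrow> ('k \<Rightarrow> real^'n^'n) \<Rightarrow> bool" where
  "friedrichs_symmetric_hyperbolic M H \<longleftrightarrow>
     symmetric_matrix M \<and> positive_definite M \<and> (\<forall>k. symmetric_matrix (H k))"


section \<open>The Maxwell-GLM system\<close>

text \<open>A state \<open>(B, \<phi>, E, \<psi>)\<close> is stored in this order as a vector of \<open>real^8\<close>. As elements of
  the index type \<open>8\<close>, the numerals \<open>1, \<dots>, 8\<close> are pairwise distinct and exhaust the type
  (with \<open>8 = 0\<close>).\<close>

definition state :: "real^3 \<Rightarrow> real \<Rightarrow> real^3 \<Rightarrow> real \<Rightarrow> real^8" where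
  "state B \<phi> E \<psi> = vector [B$1, B$2, B$3, \<phi>, E$1, E$2, E$3, \<psi>]"

definition state_B :: "real^8 \<Rightarrow> real^3" where
  "state_B q = vector [q$1, q$2, q$3]"

definition state_phi :: "real^8 \<Rightarrow> real" where
  "state_phi q = q$4"

definition state_E :: "real^8 \<Rightarrow> real^3" where
  "state_E q = vector [q$5, q$6, q$7]"

definition state_psi :: "real^8 \<Rightarrow> real" where
  "state_psi q = q$8"

lemma state_sel [simp]:
  "state_B (state B \<phi> E \<psi>) = B" "state_phi (state B \<phi> E \<psi>) = \<phi>"
  "state_E (state B \<phi> E \<psi>) = E" "state_psi (state B \<phi> E \<psi>) = \<psi>"
  by (simp_all add: state_def state_B_def state_phi_def state_E_def state_psi_def
      vector_def vec_eq_iff forall_3)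

definition energy :: "real^8 \<Rightarrow> real" where
  "energy q = 1/2 * ((norm (state_E q))\<^sup>2 + (norm (state_B q))\<^sup>2)
            + 1/2 * ((state_psi q)\<^sup>2 + (state_phi q)\<^sup>2)"

definition energy_flux :: "real \<Rightarrow> real \<Rightarrow> real^8 \<Rightarrow> real^3" where
  "energy_flux c0 ch q = c0 *\<^sub>R cross3 (state_E q) (state_B q)
     + ch *\<^sub>R (state_psi q *\<^sub>R state_E q + state_phi q *\<^sub>R state_B q)"

definition maxwell_glm_at ::
    "real \<Rightarrow> real \<Rightarrow> (real \<Rightarrow> real^3 \<Rightarrow> real^8) \<Rightarrow> real \<Rightarrow> real^3 \<Rightarrow> bool" where
  "maxwell_glm_at c0 ch q t x \<longleftrightarrow>
     vector_derivative (\<lambda>s. state_B (q s x)) (at t)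
       + c0 *\<^sub>R curl (\<lambda>y. state_E (q t y)) x
       + ch *\<^sub>R gradient (\<lambda>y. state_phi (q t y)) x = 0 \<and>
     vector_derivative (\<lambda>s. state_phi (q s x)) (at t)
       + ch * divergence (\<lambda>y. state_B (q t y)) x = 0 \<and>
     vector_derivative (\<lambda>s. state_E (q s x)) (at t)
       - c0 *\<^sub>R curl (\<lambda>y. state_B (q t y)) x
       + ch *\<^sub>R gradient (\<lambda>y. state_psi (q t y)) x = 0 \<and>
     vector_derivative (\<lambda>s. state_psi (q s x)) (at t)
       + ch * divergence (\<lambda>y. state_E (q t y)) x = 0"

definition glm_action :: "real \<Rightarrow> real \<Rightarrow> 3 \<Rightarrow> real^8 \<Rightarrow> real^8" where
  "glm_action c0 ch k v = state
     (c0 *\<^sub>R cross3 (axis k 1) (state_E v) + (ch * state_phi v) *\<^sub>R axis k 1)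
     (ch * state_B v $ k)
     (- (c0 *\<^sub>R cross3 (axis k 1) (state_B v)) + (ch * state_psi v) *\<^sub>R axis k 1)
     (ch * state_E v $ k)"

end

theory Submission
  imports Defs
begin

text \<open>
  The theorem is linear algebra on the state space, once derivatives are moved past constant
  linear maps. Let \<open>A\<^sub>k\<close> be \<open>glm_action c0 ch k\<close>. Collecting the eight scalar
  equations shows that the Maxwell-GLM system reads
  \<open>\<partial>\<^sub>t q + (\<Sum>k. A\<^sub>k (\<partial>\<^sub>k q)) = 0\<close> (\<open>maxwell_glm_at_iff\<close>), and \<open>A\<^sub>k\<close> is self-adjoint
  (\<open>glm_action_selfadjoint\<close>): its off-diagonal blocks are \<open>c0\<close> and \<open>-c0\<close> times the
  skew-symmetric map \<open>e\<^sub>k \<times> _\<close>, so that each is the transpose of the other, while the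
  divergence cleaning terms pair the gradient of \<open>\<phi>\<close> or \<open>\<psi>\<close> with the divergence of
  \<open>B\<close> or \<open>E\<close> with the same coefficient \<open>ch\<close>.

  Everything else follows from these two facts. The energy is \<open>(q \<bullet> q) / 2\<close> and the
  \<open>k\<close>-th component of its flux is the quadratic form \<open>(q \<bullet> A\<^sub>k q) / 2\<close>
  (\<open>energy_eq_inner\<close>, \<open>energy_flux_eq_inner\<close>). By self-adjointness their derivatives are
  \<open>q \<bullet> \<partial>\<^sub>t q\<close> and \<open>q \<bullet> A\<^sub>k (\<partial>\<^sub>k q)\<close>, so the left-hand side of the energy law is
  the inner product of \<open>q\<close> with the left-hand side of the system.

  Since the energy is half the squared norm, its gradient is the identity and it is its own
  Legendre transform. Hence \<open>p = q\<close>, the Hessian \<open>M\<close> is the identity, and the system in the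
  \<open>p\<close> variables is literally the system above, with the matrices of the \<open>A\<^sub>k\<close> as \<open>H\<^sub>k\<close>.
\<close>


section \<open>Derivatives along curves and coordinate lines\<close>

lemma coordinate_line_has_vector_derivative:
  "((\<lambda>s. x + s *\<^sub>R axis i 1) has_vector_derivative (axis i 1 :: real^'n::finite)) (at t)"
proof -
  have "((\<lambda>s. s *\<^sub>R axis i 1) has_vector_derivative (axis i 1 :: real^'n)) (at t)"
    using bounded_linear.has_vector_derivative[OF bounded_linear_scaleR_left has_vector_derivative_id]
    by simp
  from has_vector_derivative_add[OF has_vector_derivative_const[of x] this]
  show ?thesis
    by simp
qed

lemma partial_deriv_works:
  fixes f :: "real^'n::finite \<Rightarrow> 'b::real_normed_vector"
  assumes "f differentiable (at x)"
  shows "((\<lambda>s. f (x + s *\<^sub>R axis i 1)) has_vector_derivative partial_deriv i f x) (at 0)"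
proof -
  have "(\<lambda>s. x + s *\<^sub>R axis i 1) differentiable (at (0::real))"
    using coordinate_line_has_vector_derivative by (rule differentiableI_vector)
  moreover have "f differentiable (at (x + 0 *\<^sub>R axis i 1))"
    using assms by simp
  ultimately have "(f \<circ> (\<lambda>s. x + s *\<^sub>R axis i 1)) differentiable (at (0::real))"
    by (intro differentiable_chain_at)
  then show ?thesis
    by (simp add: partial_deriv_def o_def vector_derivative_works)
qed

lemma partial_deriv_eqI:
  assumes "((\<lambda>s. f (x + s *\<^sub>R axis i 1)) has_vector_derivative d) (at 0)"
  shows "partial_deriv i f x = d"
  using assms by (simp add: partial_deriv_def vector_derivative_at)

lemma partial_deriv_linear:
  fixes f :: "real^'n::finite \<Rightarrow> 'b::real_normed_vector"
  assumes "bounded_linear L" and "f differentiable (at x)"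
  shows "partial_deriv i (\<lambda>y. L (f y)) x = L (partial_deriv i f x)"
  by (intro partial_deriv_eqI bounded_linear.has_vector_derivative[OF assms(1)]
      partial_deriv_works assms(2))

lemma vector_derivative_linear:
  assumes "bounded_linear L" and "f differentiable (at t)"
  shows "vector_derivative (\<lambda>s. L (f s)) (at t) = L (vector_derivative f (at t))"
  by (rule vector_derivative_at, rule bounded_linear.has_vector_derivative[OF assms(1)])
    (rule vector_derivative_works[THEN iffD1, OF assms(2)])

text \<open>Self-adjointness merges the two terms of the product rule, which is why no symmetrization
  of \<open>A\<close> appears. Both the energy and the components of its flux are instances.\<close>

lemma has_vector_derivative_quadratic_form:
  fixes A :: "'a::real_inner \<Rightarrow> 'a"
  assumes A: "bounded_linear A" and self: "\<And>u v. u \<bullet> A v = A u \<bullet> v"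
    and g: "(g has_vector_derivative g') (at t)"
  shows "((\<lambda>s. g s \<bullet> A (g s) / 2) has_vector_derivative g t \<bullet> A g') (at t)"
proof -
  have "((\<lambda>s. g s \<bullet> A (g s)) has_vector_derivative g t \<bullet> A g' + g' \<bullet> A (g t)) (at t)"
    by (intro bounded_bilinear.has_vector_derivative[OF bounded_bilinear_inner]
        bounded_linear.has_vector_derivative[OF A] g)
  then have "((\<lambda>s. g s \<bullet> A (g s) / 2) has_vector_derivative
      (g t \<bullet> A g' + g' \<bullet> A (g t)) / 2) (at t)"
    by (intro bounded_linear.has_vector_derivative[OF bounded_linear_divide])
  moreover have "g' \<bullet> A (g t) = g t \<bullet> A g'"
    using self[of g' "g t"] by (simp add: inner_commute)
  ultimately show ?thesis
    by simp
qed

lemma smooth_imp_differentiable: "smooth f \<Longrightarrow> f differentiable (at z)"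
  unfolding smooth_def by (drule spec[of _ 1]) simp

lemma smooth_slices_differentiable:
  fixes q :: "real \<Rightarrow> 'a::real_normed_vector \<Rightarrow> 'b::real_normed_vector"
  assumes "smooth (\<lambda>(t, x). q t x)"
  shows "(\<lambda>s. q s x) differentiable (at t)" and "(\<lambda>y. q t y) differentiable (at x)"
proof -
  note diff = smooth_imp_differentiable[OF assms, of "(t, x)"]
  have "(\<lambda>s. (s, x)) differentiable (at t)"
    unfolding differentiable_def by (rule exI) (rule derivative_intros)+
  then have "((\<lambda>(t, x). q t x) \<circ> (\<lambda>s. (s, x))) differentiable (at t)"
    using diff by (intro differentiable_chain_at) auto
  then show "(\<lambda>s. q s x) differentiable (at t)"
    by (simp add: o_def)
  have "(\<lambda>y. (t, y)) differentiable (at x)"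
    unfolding differentiable_def by (rule exI) (rule derivative_intros)+
  then have "((\<lambda>(t, x). q t x) \<circ> (\<lambda>y. (t, y))) differentiable (at x)"
    using diff by (intro differentiable_chain_at) auto
  then show "(\<lambda>y. q t y) differentiable (at x)"
    by (simp add: o_def)
qed


section \<open>The block structure of the state space\<close>

lemma UNIV_8: "(UNIV :: 8 set) = {1, 2, 3, 4, 5, 6, 7, 8}"
proof (rule sym, rule card_subset_eq)
  show "card {1, 2, 3, 4, 5, 6, 7, 8 :: 8} = card (UNIV :: 8 set)"
    by simp
qed simp_all

lemma forall_8: "(\<forall>i::8. P i) \<longleftrightarrow> P 1 \<and> P 2 \<and> P 3 \<and> P 4 \<and> P 5 \<and> P 6 \<and> P 7 \<and> P 8"
proof -
  have "(\<forall>i. P i) \<longleftrightarrow> (\<forall>i\<in>UNIV. P i)"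
    by blast
  then show ?thesis
    by (simp only: UNIV_8 ball_simps simp_thms)
qed

lemma sum_8: "sum f (UNIV :: 8 set) = f 1 + f 2 + f 3 + f 4 + f 5 + f 6 + f 7 + f 8"
proof -
  have "distinct [1, 2, 3, 4, 5, 6, 7, 8 :: 8]"
    by simp
  from sum.distinct_set_conv_list[OF this, of f] show ?thesis
    by (simp only: UNIV_8 list.set list.map sum_list.Cons sum_list.Nil add.assoc add_0_right)
qed

lemma vec_eq_iff_state:
  "u = v \<longleftrightarrow> state_B u = state_B v \<and> state_phi u = state_phi v \<and>
     state_E u = state_E v \<and> state_psi u = state_psi v"
  unfolding state_B_def state_phi_def state_E_def state_psi_def vec_eq_iff forall_3 forall_8
  by (simp only: vector_3 conj_assoc)

lemma inner_state:
  "u \<bullet> v = state_B u \<bullet> state_B v + state_phi u * state_phi v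
     + state_E u \<bullet> state_E v + state_psi u * state_psi v"
  unfolding inner_vec_def sum_8 sum_3 state_B_def state_phi_def state_E_def state_psi_def vector_3
    inner_real_def
  by (simp only: add.assoc)

lemma state_add [simp]:
  "state_B (u + v) = state_B u + state_B v" "state_phi (u + v) = state_phi u + state_phi v"
  "state_E (u + v) = state_E u + state_E v" "state_psi (u + v) = state_psi u + state_psi v"
  by (simp_all add: state_B_def state_phi_def state_E_def state_psi_def vec_eq_iff forall_3 vector_3)

lemma state_scaleR [simp]:
  "state_B (r *\<^sub>R u) = r *\<^sub>R state_B u" "state_phi (r *\<^sub>R u) = r * state_phi u"
  "state_E (r *\<^sub>R u) = r *\<^sub>R state_E u" "state_psi (r *\<^sub>R u) = r * state_psi u"
  by (simp_all add: state_B_def state_phi_def state_E_def state_psi_def vec_eq_iff forall_3 vector_3)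

lemma state_zero [simp]:
  "state_B 0 = 0" "state_phi 0 = 0" "state_E 0 = 0" "state_psi 0 = 0"
  using state_scaleR[of 0 0] by simp_all

lemma bounded_linear_state:
  "bounded_linear state_B" "bounded_linear state_phi"
  "bounded_linear state_E" "bounded_linear state_psi"
  by (auto intro!: linear_conv_bounded_linear[THEN iffD1] linearI)


section \<open>The flux operators\<close>

lemma glm_action_sel [simp]:
  "state_B (glm_action c0 ch k v) =
     c0 *\<^sub>R cross3 (axis k 1) (state_E v) + (ch * state_phi v) *\<^sub>R axis k 1"
  "state_phi (glm_action c0 ch k v) = ch * state_B v $ k"
  "state_E (glm_action c0 ch k v) =
     - (c0 *\<^sub>R cross3 (axis k 1) (state_B v)) + (ch * state_psi v) *\<^sub>R axis k 1"
  "state_psi (glm_action c0 ch k v) = ch * state_E v $ k"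
  by (simp_all add: glm_action_def)

lemma linear_glm_action: "linear (glm_action c0 ch k)"
  by (rule linearI)
    (simp_all add: vec_eq_iff_state[of "glm_action _ _ _ _"] cross_add_right cross_mult_right
      algebra_simps)

lemma glm_action_selfadjoint:
  "u \<bullet> glm_action c0 ch k v = glm_action c0 ch k u \<bullet> v"
proof -
  \<comment> \<open>The map \<open>e\<^sub>k \<times> _\<close> is skew-symmetric; its sign is absorbed by the opposite signs of
    the two curls in the system.\<close>
  have "x \<bullet> cross3 (axis k 1) y = - (cross3 (axis k 1) x \<bullet> y)" for x y :: "real^3"
    by (simp add: cross3_def inner_vec_def sum_3 algebra_simps)
  then show ?thesis
    by (simp add: inner_state inner_add_left inner_add_right inner_axis inner_axis'
        algebra_simps)
qed

lemma energy_eq_inner: "energy q = q \<bullet> q / 2"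
  unfolding energy_def inner_state power2_norm_eq_inner by (simp add: power2_eq_square field_simps)

text \<open>The factor \<open>1/2\<close> appears because every flux term occurs twice in the quadratic form:
  the two curl blocks give the same triple product \<open>(E \<times> B)\<^sub>k\<close>, and \<open>\<phi> B\<^sub>k\<close> and
  \<open>\<psi> E\<^sub>k\<close> each come once from a gradient and once from a divergence.\<close>

lemma energy_flux_eq_inner: "energy_flux c0 ch q $ k = q \<bullet> glm_action c0 ch k q / 2"
proof -
  have "x \<bullet> cross3 (axis k 1) y = cross3 y x $ k" for x y :: "real^3"
    using exhaust_3[of k]
    by (auto simp: cross3_def inner_vec_def sum_3 axis_def algebra_simps)
  moreover have "cross3 (state_B q) (state_E q) = - cross3 (state_E q) (state_B q)"
    by (rule cross_skew)
  ultimately show ?thesis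
    by (simp add: energy_flux_def inner_state inner_add_right inner_axis algebra_simps)
qed


section \<open>The system as a first-order equation for the state\<close>

lemma curl_eq_sum_cross:
  assumes "F differentiable (at x)"
  shows "curl F x = (\<Sum>k\<in>UNIV. cross3 (axis k 1) (partial_deriv k F x))"
  by (simp add: curl_def partial_deriv_linear[OF bounded_linear_vec_nth assms] sum_3
      vec_eq_iff forall_3 cross3_def axis_def)

lemma divergence_eq_sum:
  assumes "F differentiable (at x)"
  shows "divergence F x = (\<Sum>k\<in>UNIV. partial_deriv k F x $ k)"
  by (simp add: divergence_def partial_deriv_linear[OF bounded_linear_vec_nth assms])

lemma gradient_eq_sum: "gradient f x = (\<Sum>k\<in>UNIV. partial_deriv k f x *\<^sub>R axis k 1)"
  by (simp add: vec_eq_iff gradient_def axis_def if_distrib cong: if_cong)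

text \<open>Differentiability is essential: the derivatives in the system are taken of the
  blocks \<open>B\<close>, \<open>\<phi>\<close>, \<open>E\<close>, \<open>\<psi>\<close> separately, and for non-differentiable functions
  the default values of \<open>vector_derivative\<close> need not commute with the projections to the
  blocks.\<close>

lemma maxwell_glm_at_iff:
  assumes t: "(\<lambda>s. q s x) differentiable (at t)"
    and x: "(\<lambda>y. q t y) differentiable (at x)"
  shows "maxwell_glm_at c0 ch q t x \<longleftrightarrow>
    vector_derivative (\<lambda>s. q s x) (at t)
      + (\<Sum>k\<in>UNIV. glm_action c0 ch k (partial_deriv k (\<lambda>y. q t y) x)) = 0"
proof -
  note dt = bounded_linear_state[THEN vector_derivative_linear, OF t]
  note dx = bounded_linear_state[THEN partial_deriv_linear, OF x]
  note diff = bounded_linear_state[THEN bounded_linear_imp_differentiable,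
      THEN differentiable_chain_at[OF x], unfolded o_def]
  show ?thesis
    unfolding maxwell_glm_at_def vec_eq_iff_state[of _ 0]
    by (simp add: curl_eq_sum_cross divergence_eq_sum gradient_eq_sum diff dt dx
        sum_3 algebra_simps)
qed


section \<open>Energy conservation\<close>

lemma energy_balance:
  assumes t: "(\<lambda>s. q s x) differentiable (at t)"
    and x: "(\<lambda>y. q t y) differentiable (at x)"
  shows "vector_derivative (\<lambda>s. energy (q s x)) (at t)
      + divergence (\<lambda>y. energy_flux c0 ch (q t y)) x =
    q t x \<bullet> (vector_derivative (\<lambda>s. q s x) (at t)
      + (\<Sum>k\<in>UNIV. glm_action c0 ch k (partial_deriv k (\<lambda>y. q t y) x)))"
proof -
  have "vector_derivative (\<lambda>s. energy (q s x)) (at t) =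
      q t x \<bullet> vector_derivative (\<lambda>s. q s x) (at t)"
    unfolding energy_eq_inner
    using has_vector_derivative_quadratic_form[OF bounded_linear_ident _
        vector_derivative_works[THEN iffD1, OF t]]
    by (intro vector_derivative_at) simp
  moreover have "partial_deriv k (\<lambda>y. energy_flux c0 ch (q t y) $ k) x =
      q t x \<bullet> glm_action c0 ch k (partial_deriv k (\<lambda>y. q t y) x)" for k
    unfolding energy_flux_eq_inner
    using has_vector_derivative_quadratic_form[OF
        linear_conv_bounded_linear[THEN iffD1, OF linear_glm_action] glm_action_selfadjoint
        partial_deriv_works[OF x]]
    by (intro partial_deriv_eqI) simp
  ultimately show ?thesis
    by (simp add: divergence_def inner_add_right inner_sum_right)
qed


section \<open>The energy as a potential\<close>

lemma gradient_energy [simp]: "gradient energy q = q"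
proof -
  have "partial_deriv i energy q = q $ i" for i
  proof (rule partial_deriv_eqI)
    from has_vector_derivative_quadratic_form[OF bounded_linear_ident _
        coordinate_line_has_vector_derivative[of q i 0]]
    show "((\<lambda>s. energy (q + s *\<^sub>R axis i 1)) has_vector_derivative q $ i) (at 0)"
      unfolding energy_eq_inner by (simp add: inner_axis)
  qed
  then show ?thesis
    by (simp add: gradient_def vec_eq_iff)
qed

lemma legendre_energy: "legendre energy = energy"
  by (rule ext) (simp add: legendre_def energy_eq_inner)

lemma hessian_energy: "hessian energy p = mat 1"
proof -
  have first: "partial_deriv j energy = (\<lambda>q. q $ j)" for j
  proof
    show "partial_deriv j energy q = q $ j" for q
      using gradient_energy[of q] by (simp add: gradient_def vec_eq_iff)
  qed
  have "partial_deriv i (\<lambda>q. q $ j) p = axis i 1 $ j" for i j :: 8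
    by (intro partial_deriv_eqI coordinate_line_has_vector_derivative
        bounded_linear.has_vector_derivative[OF bounded_linear_vec_nth])
  then show ?thesis
    by (simp add: hessian_def first vec_eq_iff mat_def axis_def)
qed

lemma symmetric_matrix_of_selfadjoint:
  fixes f :: "real^'n::finite \<Rightarrow> real^'n"
  assumes "linear f" and "\<And>u v. u \<bullet> f v = f u \<bullet> v"
  shows "symmetric_matrix (matrix f)"
proof -
  have "adjoint f = f"
    using assms(2) by (intro adjoint_unique) simp
  then show ?thesis
    using matrix_adjoint[OF assms(1)] by (simp add: symmetric_matrix_def)
qed


section \<open>Energy law and symmetric hyperbolicity of the Maxwell-GLM system\<close>

theorem mainTheorem2:
  fixes c0 ch :: real
  assumes "c0 > 0" and "ch > 0"
  shows "(\<forall>q :: real \<Rightarrow> real^3 \<Rightarrow> real^8.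
            smooth (\<lambda>(t, x). q t x) \<and> (\<forall>t x. maxwell_glm_at c0 ch q t x) \<longrightarrow>
            (\<forall>t x. vector_derivative (\<lambda>s. energy (q s x)) (at t)
                     + divergence (\<lambda>y. energy_flux c0 ch (q t y)) x = 0))
       \<and> (\<exists>(M :: real^8^8) (H :: 3 \<Rightarrow> real^8^8).
            friedrichs_symmetric_hyperbolic M H \<and>
            M = mat 1 \<and> (\<forall>p. hessian (legendre energy) p = M) \<and>
            (\<forall>k v. H k *v v = glm_action c0 ch k v) \<and>
            (\<forall>q :: real \<Rightarrow> real^3 \<Rightarrow> real^8. smooth (\<lambda>(t, x). q t x) \<longrightarrow>
               (\<forall>t x. maxwell_glm_at c0 ch q t x \<longleftrightarrow>
                  M *v vector_derivative (\<lambda>s. gradient energy (q s x)) (at t)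
                    + (\<Sum>k\<in>UNIV. H k *v partial_deriv k (\<lambda>y. gradient energy (q t y)) x) = 0)))"
proof -
  define H where "H k = matrix (glm_action c0 ch k)" for k
  have H: "H k *v v = glm_action c0 ch k v" for k v
    by (simp add: H_def matrix_works linear_glm_action)
  have "friedrichs_symmetric_hyperbolic (mat 1) H"
    unfolding friedrichs_symmetric_hyperbolic_def positive_definite_def H_def
    by (simp add: symmetric_matrix_def[of "mat 1"] symmetric_matrix_of_selfadjoint
        linear_glm_action glm_action_selfadjoint)
  moreover have "hessian (legendre energy) p = mat 1" for p
    by (simp add: legendre_energy hessian_energy)
  moreover have "maxwell_glm_at c0 ch q t x \<longleftrightarrow>
      mat 1 *v vector_derivative (\<lambda>s. gradient energy (q s x)) (at t)
        + (\<Sum>k\<in>UNIV. H k *v partial_deriv k (\<lambda>y. gradient energy (q t y)) x) = 0"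
    if "smooth (\<lambda>(t, x). q t x)" for q :: "real \<Rightarrow> real^3 \<Rightarrow> real^8" and t x
    using maxwell_glm_at_iff[where q = q] smooth_slices_differentiable[OF that] by (simp add: H)
  moreover have "vector_derivative (\<lambda>s. energy (q s x)) (at t)
      + divergence (\<lambda>y. energy_flux c0 ch (q t y)) x = 0"
    if "smooth (\<lambda>(t, x). q t x)" and "maxwell_glm_at c0 ch q t x"
    for q :: "real \<Rightarrow> real^3 \<Rightarrow> real^8" and t x
    using that(2) energy_balance[where q = q] maxwell_glm_at_iff[where q = q]
      smooth_slices_differentiable[OF that(1)]
    by simp
  ultimately show ?thesis
    using H by (intro conjI allI impI exI[of _ "mat 1"] exI[of _ H]) auto
qed

end
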